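(* Let $T$ be an algebraic torus acting linearly on a finite-dimensional vector space $V$ over an algebraically closed field $k$, and let $X\subset V$ be a $T$-invariant subset. If $X$ does not have the separation property (SP) and $Ch(X)$ is closed in $\mathbb{P}(V^* )\times\mathbb{P}(V^* )$, then there exists a pair $(\langle\alpha\rangle,\langle\beta\rangle)\in Ch(X)$ such that $\alpha,\beta\in V^*$ are $T$-semiinvariant and linearly independent.
   Context: A subset $X$ of a vector space $V$ has the separation property (SP) if for any pair of linearly independent linear functions $\alpha,\beta\in V^*$ there exists $x\in X$ with $\alpha(x)=0$ and $\beta(x)\neq0$. For nonzero $\alpha\in V^*$, $\langle\alpha\rangle\in\mathbb{P}(V^* )$ is the corresponding point. The characteristic variety of $X$ is $$Ch(X)=\{(\langle\alpha\rangle,\langle\beta\rangle)\in\mathbb{P}(V^* )\times\mathbb{P}(V^* )\mid \text{for all } x\in X:\ \alpha(x)=0\Rightarrow\beta(x)=0\}.$$ A linear function is $T$-semiinvariant if it is a $T$-weight vector in $V^*$ (i.e. $T$ acts on it by a character). Closed means Zariski closed. *)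

theory Defs
  imports
    "HOL-Algebra.Group_Action"
    "HOL-Algebra.Product_Groups"
    "HOL-Computational_Algebra.Polynomial"
begin

section \<open>Tori and their rational representations\<close>

definition Gm :: "'k::field monoid" where
  "Gm = \<lparr>carrier = - {0}, monoid.mult = (*), one = 1\<rparr>"

definition Gm_power :: "nat \<Rightarrow> (nat \<Rightarrow> 'k::field) monoid" where
  "Gm_power n = product_group {..<n} (\<lambda>_. Gm)"

text \<open>Coordinate rings consist of functions on the carrier; the values of their elements off the
  carrier are irrelevant. The coordinate ring of \<open>Gm_power n\<close> consists of the Laurent polynomials;
  exponent vectors are functions \<open>nat \<Rightarrow> int\<close> of which only the values below \<open>n\<close> matter.\<close>

definition laurent_functions :: "nat \<Rightarrow> ((nat \<Rightarrow> 'k::field) \<Rightarrow> 'k) set" where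
  "laurent_functions n =
    {f. \<exists>(E :: (nat \<Rightarrow> int) set) c. finite E \<and>
          (\<forall>t \<in> carrier (Gm_power n). f t = (\<Sum>e\<in>E. c e * (\<Prod>i<n. t i powi e i)))}"

text \<open>Over an algebraically closed field, an affine algebraic group is given by its group of points
  \<open>T\<close> together with its coordinate ring \<open>R\<close>. It is a torus if it is isomorphic, as an algebraic
  group, to some power of the multiplicative group: the isomorphism has to identify the
  coordinate rings as well.\<close>

definition algebraic_torus :: "('t, 'm) monoid_scheme \<Rightarrow> ('t \<Rightarrow> 'k::field) set \<Rightarrow> bool" where
  "algebraic_torus T R \<longleftrightarrow> group T \<and>
    (\<exists>n. \<exists>\<phi> \<in> iso T (Gm_power n).
       R = {f. \<exists>g \<in> laurent_functions n. \<forall>t \<in> carrier T. f t = g (\<phi> t)})"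

definition algebraic_character ::
    "('t, 'm) monoid_scheme \<Rightarrow> ('t \<Rightarrow> 'k::field) set \<Rightarrow> ('t \<Rightarrow> 'k) \<Rightarrow> bool" where
  "algebraic_character T R \<chi> \<longleftrightarrow> \<chi> \<in> hom T Gm \<and> \<chi> \<in> R"

definition dual :: "('k::field \<Rightarrow> 'v::ab_group_add \<Rightarrow> 'v) \<Rightarrow> ('v \<Rightarrow> 'k) set" where
  "dual scale = {\<alpha>. Vector_Spaces.linear scale (*) \<alpha>}"

text \<open>The last condition says that the matrix coefficients are regular functions, i.e. that the
  representation is a morphism of algebraic groups.\<close>

definition rational_representation ::
    "('t, 'm) monoid_scheme \<Rightarrow> ('t \<Rightarrow> 'k::field) set \<Rightarrow> ('k \<Rightarrow> 'v::ab_group_add \<Rightarrow> 'v) \<Rightarrow>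
     ('t \<Rightarrow> 'v \<Rightarrow> 'v) \<Rightarrow> bool" where
  "rational_representation T R scale \<rho> \<longleftrightarrow>
    group_action T UNIV \<rho> \<and>
    (\<forall>t \<in> carrier T. Vector_Spaces.linear scale scale (\<rho> t)) \<and>
    (\<forall>\<alpha> \<in> dual scale. \<forall>v. (\<lambda>t. \<alpha> (\<rho> t v)) \<in> R)"

definition dual_action ::
    "('t, 'm) monoid_scheme \<Rightarrow> ('t \<Rightarrow> 'v \<Rightarrow> 'v) \<Rightarrow> 't \<Rightarrow> ('v \<Rightarrow> 'k) \<Rightarrow> 'v \<Rightarrow> 'k" where
  "dual_action T \<rho> t \<alpha> = (\<lambda>v. \<alpha> (\<rho> (inv\<^bsub>T\<^esub> t) v))"

definition semiinvariant ::
    "('t, 'm) monoid_scheme \<Rightarrow> ('t \<Rightarrow> 'k::field) set \<Rightarrow> ('k \<Rightarrow> 'v::ab_group_add \<Rightarrow> 'v) \<Rightarrow>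
     ('t \<Rightarrow> 'v \<Rightarrow> 'v) \<Rightarrow> ('v \<Rightarrow> 'k) \<Rightarrow> bool" where
  "semiinvariant T R scale \<rho> \<alpha> \<longleftrightarrow>
    \<alpha> \<in> dual scale \<and> \<alpha> \<noteq> (\<lambda>_. 0) \<and>
    (\<exists>\<chi>. algebraic_character T R \<chi> \<and>
       (\<forall>t \<in> carrier T. dual_action T \<rho> t \<alpha> = (\<lambda>v. \<chi> t * \<alpha> v)))"


section \<open>The separation property and the characteristic variety\<close>

definition lin_indep_pair :: "('v \<Rightarrow> 'k::field) \<Rightarrow> ('v \<Rightarrow> 'k) \<Rightarrow> bool" where
  "lin_indep_pair \<alpha> \<beta> \<longleftrightarrow> (\<forall>a b. (\<forall>v. a * \<alpha> v + b * \<beta> v = 0) \<longrightarrow> a = 0 \<and> b = 0)"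

definition separation_property ::
    "('k::field \<Rightarrow> 'v::ab_group_add \<Rightarrow> 'v) \<Rightarrow> 'v set \<Rightarrow> bool" where
  "separation_property scale X \<longleftrightarrow>
    (\<forall>\<alpha> \<in> dual scale. \<forall>\<beta> \<in> dual scale. lin_indep_pair \<alpha> \<beta> \<longrightarrow>
       (\<exists>x \<in> X. \<alpha> x = 0 \<and> \<beta> x \<noteq> 0))"

text \<open>The points of the projective space of the dual are the lines through the origin.\<close>

definition proj_pt :: "('v \<Rightarrow> 'k::field) \<Rightarrow> ('v \<Rightarrow> 'k) set" where
  "proj_pt \<alpha> = range (\<lambda>c v. c * \<alpha> v)"

definition char_variety ::
    "('k::field \<Rightarrow> 'v::ab_group_add \<Rightarrow> 'v) \<Rightarrow> 'v set \<Rightarrow> (('v \<Rightarrow> 'k) set \<times> ('v \<Rightarrow> 'k) set) set" where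
  "char_variety scale X =
    {(proj_pt \<alpha>, proj_pt \<beta>) | \<alpha> \<beta>.
       \<alpha> \<in> dual scale - {\<lambda>_. 0} \<and> \<beta> \<in> dual scale - {\<lambda>_. 0} \<and>
       (\<forall>x \<in> X. \<alpha> x = 0 \<longrightarrow> \<beta> x = 0)}"

text \<open>\<open>bihomogeneous d e p\<close> means that \<open>p\<close> is a polynomial function of two linear functions that is
  homogeneous of degree \<open>d\<close> in the first and of degree \<open>e\<close> in the second one. Linear forms on the
  dual of a finite-dimensional space are exactly the evaluations at vectors, so no basis is needed.\<close>

inductive bihomogeneous ::
    "nat \<Rightarrow> nat \<Rightarrow> (('v \<Rightarrow> 'k::field) \<Rightarrow> ('v \<Rightarrow> 'k) \<Rightarrow> 'k) \<Rightarrow> bool" where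
  const: "bihomogeneous 0 0 (\<lambda>\<alpha> \<beta>. c)"
| eval_fst: "bihomogeneous 1 0 (\<lambda>\<alpha> \<beta>. \<alpha> v)"
| eval_snd: "bihomogeneous 0 1 (\<lambda>\<alpha> \<beta>. \<beta> v)"
| add: "bihomogeneous d e p \<Longrightarrow> bihomogeneous d e q \<Longrightarrow> bihomogeneous d e (\<lambda>\<alpha> \<beta>. p \<alpha> \<beta> + q \<alpha> \<beta>)"
| mult: "bihomogeneous d e p \<Longrightarrow> bihomogeneous d' e' q \<Longrightarrow>
    bihomogeneous (d + d') (e + e') (\<lambda>\<alpha> \<beta>. p \<alpha> \<beta> * q \<alpha> \<beta>)"

text \<open>The Zariski closed subsets of the product of two copies of the projective space of the dual
  are the common zero sets of families of bihomogeneous polynomials.\<close>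

definition zariski_closed ::
    "('k::field \<Rightarrow> 'v::ab_group_add \<Rightarrow> 'v) \<Rightarrow> (('v \<Rightarrow> 'k) set \<times> ('v \<Rightarrow> 'k) set) set \<Rightarrow> bool" where
  "zariski_closed scale Z \<longleftrightarrow>
    (\<exists>F. (\<forall>p \<in> F. \<exists>d e. bihomogeneous d e p) \<and>
       Z = {(proj_pt \<alpha>, proj_pt \<beta>) | \<alpha> \<beta>.
              \<alpha> \<in> dual scale - {\<lambda>_. 0} \<and> \<beta> \<in> dual scale - {\<lambda>_. 0} \<and>
              (\<forall>p \<in> F. p \<alpha> \<beta> = 0)})"

end

theory Submission
  imports Defs
begin

text \<open>The torus is generated by \<open>n\<close> commuting one-parameter subgroups, the coordinate copies of
  the multiplicative group. Along one of them, \<open>\<alpha> (s \<cdot> v)\<close> is a Laurent polynomial in \<open>s\<close>; the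
  coefficient of the lowest power of \<open>s\<close> is a weight function \<open>\<alpha>'\<close>, and \<open>\<langle>\<alpha>'\<rangle>\<close> is the limit of the
  orbit of \<open>\<langle>\<alpha>\<rangle>\<close> as \<open>s \<rightarrow> 0\<close>. Start with independent \<open>\<alpha>, \<beta>\<close> violating the separation property.
  After replacing \<open>\<beta>\<close> by some \<open>\<beta> - c \<alpha>\<close>, which still vanishes where \<open>\<alpha>\<close> does on \<open>X\<close>, the two
  initial forms are independent, and the limit pair lies in the closed set \<open>Ch(X)\<close>. Functions that
  are already weight functions for other coordinates remain so, hence treating the coordinates one
  after another produces a pair of semiinvariants.\<close>

section \<open>Polynomial identities over algebraically closed fields\<close>

text \<open>Over a finite field, one plus the product of all X - a would be a nonconstant polynomial
  without a root.\<close>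

lemma infinite_UNIV_alg_closed: "infinite (UNIV :: 'k::alg_closed_field set)"
proof
  assume fin: "finite (UNIV :: 'k set)"
  define p :: "'k poly" where "p = (\<Prod>a\<in>UNIV. [:-a, 1:])"
  have "degree p = card (UNIV :: 'k set)"
    unfolding p_def by (subst degree_prod_eq_sum_degree) auto
  then have "degree p > 0"
    using fin by (simp add: card_gt_0_iff)
  moreover have "degree (1 :: 'k poly) = 0"
    by simp
  ultimately have "degree (p + 1) > 0"
    by (simp add: degree_add_eq_left)
  then obtain x where "poly (p + 1) x = 0"
    using alg_closed_imp_poly_has_root by blast
  moreover have "poly p x = 0"
    unfolding p_def poly_prod using fin by (intro prod_zero) auto
  ultimately show False
    by simp
qed

text \<open>The difference would have infinitely many roots. This is how limits are taken
  algebraically: an identity that holds at all nonzero \<open>s\<close> extends to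
  \<open>s = 0\<close>.\<close>

lemma poly_eqI_nonzero:
  fixes p q :: "'k::alg_closed_field poly"
  assumes "\<And>s. s \<noteq> 0 \<Longrightarrow> poly p s = poly q s"
  shows "p = q"
proof (rule ccontr)
  assume "p \<noteq> q"
  then have "finite {s. poly (p - q) s = 0}"
    by (intro poly_roots_finite) simp
  moreover have "- {0} \<subseteq> {s. poly (p - q) s = 0}"
    using assms by auto
  ultimately have "finite (- {0::'k})"
    by (rule rev_finite_subset)
  then show False
    using infinite_UNIV_alg_closed[where 'k = 'k] by (simp add: finite_compl)
qed

text \<open>Dividing by the lower power would leave a monomial of positive degree that equals 1 at
  every nonzero point.\<close>

lemma power_int_eq_imp_exponent_eq:
  assumes "\<And>r :: 'k::alg_closed_field. r \<noteq> 0 \<Longrightarrow> r powi m = r powi n"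
  shows "m = n"
proof -
  have False if less: "i < j" and eq: "\<And>r :: 'k. r \<noteq> 0 \<Longrightarrow> r powi i = r powi j" for i j :: int
  proof -
    have "monom 1 (nat (j - i)) = (1 :: 'k poly)"
    proof (rule poly_eqI_nonzero)
      fix s :: 'k assume s: "s \<noteq> 0"
      then have "s powi (j - i) = 1"
        using eq[OF s] by (simp add: power_int_diff)
      then show "poly (monom 1 (nat (j - i))) s = poly 1 s"
        using less by (simp add: poly_monom power_int_nonneg_exp)
    qed
    then have "degree (monom (1::'k) (nat (j - i))) = 0"
      by simp
    then show False
      using less by (simp add: degree_monom_eq)
  qed
  from this[of m n] this[of n m] show ?thesis
    using assms by (metis linorder_neqE)
qed

section \<open>Bihomogeneous functions under scaling and along polynomial curves\<close>

lemma bihomogeneous_scale: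
  "bihomogeneous d e p \<Longrightarrow> p (\<lambda>v. a * \<alpha> v) (\<lambda>v. b * \<beta> v) = a ^ d * b ^ e * p \<alpha> \<beta>"
  by (induction rule: bihomogeneous.induct) (auto simp: algebra_simps power_add)

text \<open>Such a function is built from evaluations by sums and products, and polynomials in
  \<open>s\<close> are closed under both.\<close>

lemma bihomogeneous_poly:
  assumes "bihomogeneous d e p"
  shows "\<exists>q. \<forall>s. p (\<lambda>v. poly (f v) s) (\<lambda>v. poly (g v) s) = poly q s"
  using assms
proof (induction rule: bihomogeneous.induct)
  case (const c)
  show ?case by (rule exI[of _ "[:c:]"]) simp
next
  case (add d e p q)
  then show ?case by (metis poly_add)
next
  case (mult d e p d' e' q)
  then show ?case by (metis poly_mult)
qed auto


section \<open>Linear functions and their projective classes\<close>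

lemma dual_iff:
  assumes "vector_space scale"
  shows "\<alpha> \<in> dual scale \<longleftrightarrow>
    (\<forall>v w. \<alpha> (v + w) = \<alpha> v + \<alpha> w) \<and> (\<forall>c v. \<alpha> (scale c v) = c * \<alpha> v)"
proof -
  have "vector_space ((*) :: 'a::field \<Rightarrow> _)"
    by unfold_locales (auto simp: algebra_simps)
  then show ?thesis
    using assms by (auto simp: dual_def Vector_Spaces.linear_iff)
qed

lemma proj_pt_eqE:
  assumes "proj_pt \<alpha> = proj_pt \<alpha>'" "\<alpha> \<noteq> (\<lambda>_. 0)"
  obtains c where "c \<noteq> 0" "\<alpha> = (\<lambda>v. c * \<alpha>' v)"
proof -
  have "\<alpha> \<in> proj_pt \<alpha>"
    unfolding proj_pt_def by (rule range_eqI[of _ _ 1]) simp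
  then obtain c where c: "\<alpha> = (\<lambda>v. c * \<alpha>' v)"
    using assms(1) by (auto simp: proj_pt_def)
  then have "c \<noteq> 0"
    using assms(2) by auto
  with c that show thesis by blast
qed

text \<open>Membership in the set only provides some representatives of the two points; the
  vanishing condition is insensitive to nonzero scalars, so any representatives will do.\<close>

lemma char_variety_iff:
  assumes "\<alpha> \<in> dual scale - {\<lambda>_. 0}" "\<beta> \<in> dual scale - {\<lambda>_. 0}"
  shows "(proj_pt \<alpha>, proj_pt \<beta>) \<in> char_variety scale X \<longleftrightarrow> (\<forall>x\<in>X. \<alpha> x = 0 \<longrightarrow> \<beta> x = 0)"
proof
  assume "(proj_pt \<alpha>, proj_pt \<beta>) \<in> char_variety scale X"
  then obtain \<alpha>' \<beta>' where eq: "proj_pt \<alpha> = proj_pt \<alpha>'" "proj_pt \<beta> = proj_pt \<beta>'"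
      and van: "\<forall>x\<in>X. \<alpha>' x = 0 \<longrightarrow> \<beta>' x = 0"
    by (auto simp: char_variety_def)
  obtain a where "a \<noteq> 0" "\<alpha> = (\<lambda>v. a * \<alpha>' v)"
    using proj_pt_eqE[OF eq(1)] assms(1) by blast
  moreover obtain b where "b \<noteq> 0" "\<beta> = (\<lambda>v. b * \<beta>' v)"
    using proj_pt_eqE[OF eq(2)] assms(2) by blast
  ultimately show "\<forall>x\<in>X. \<alpha> x = 0 \<longrightarrow> \<beta> x = 0"
    using van by simp
next
  assume "\<forall>x\<in>X. \<alpha> x = 0 \<longrightarrow> \<beta> x = 0"
  with assms show "(proj_pt \<alpha>, proj_pt \<beta>) \<in> char_variety scale X"
    unfolding char_variety_def by blast
qed

text \<open>Again independence of representatives: by bihomogeneity, a zero of \<open>p\<close>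
  stays a zero under rescaling of either argument.\<close>

lemma zariski_closedE:
  assumes "zariski_closed scale Z"
  obtains F where "\<And>p. p \<in> F \<Longrightarrow> \<exists>d e. bihomogeneous d e p"
    and "\<And>\<alpha> \<beta>. \<alpha> \<in> dual scale - {\<lambda>_. 0} \<Longrightarrow> \<beta> \<in> dual scale - {\<lambda>_. 0} \<Longrightarrow>
      (proj_pt \<alpha>, proj_pt \<beta>) \<in> Z \<longleftrightarrow> (\<forall>p\<in>F. p \<alpha> \<beta> = 0)"
proof -
  obtain F where F: "\<forall>p\<in>F. \<exists>d e. bihomogeneous d e p"
    and Z: "Z = {(proj_pt \<alpha>, proj_pt \<beta>) | \<alpha> \<beta>.
              \<alpha> \<in> dual scale - {\<lambda>_. 0} \<and> \<beta> \<in> dual scale - {\<lambda>_. 0} \<and> (\<forall>p \<in> F. p \<alpha> \<beta> = 0)}"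
    using assms unfolding zariski_closed_def by blast
  show thesis
  proof (rule that)
    fix \<alpha> \<beta> assume ab: "\<alpha> \<in> dual scale - {\<lambda>_. 0}" "\<beta> \<in> dual scale - {\<lambda>_. 0}"
    show "(proj_pt \<alpha>, proj_pt \<beta>) \<in> Z \<longleftrightarrow> (\<forall>p\<in>F. p \<alpha> \<beta> = 0)"
    proof
      assume "(proj_pt \<alpha>, proj_pt \<beta>) \<in> Z"
      then obtain \<alpha>' \<beta>' where eq: "proj_pt \<alpha> = proj_pt \<alpha>'" "proj_pt \<beta> = proj_pt \<beta>'"
        and van: "\<forall>p\<in>F. p \<alpha>' \<beta>' = 0"
        unfolding Z by auto
      obtain a where a: "\<alpha> = (\<lambda>v. a * \<alpha>' v)"
        using proj_pt_eqE[OF eq(1)] ab(1) by blast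
      obtain b where b: "\<beta> = (\<lambda>v. b * \<beta>' v)"
        using proj_pt_eqE[OF eq(2)] ab(2) by blast
      show "\<forall>p\<in>F. p \<alpha> \<beta> = 0"
      proof
        fix p assume p: "p \<in> F"
        then obtain d e where "bihomogeneous d e p"
          using F by blast
        then show "p \<alpha> \<beta> = 0"
          unfolding a b using van p by (simp add: bihomogeneous_scale)
      qed
    qed (use Z ab in blast)
  qed (use F in blast)
qed

lemma lin_indep_pair_nonzero:
  assumes "lin_indep_pair \<alpha> \<beta>"
  shows "\<alpha> \<noteq> (\<lambda>_. 0)" "(\<lambda>v. \<beta> v - c * \<alpha> v) \<noteq> (\<lambda>_. 0)"
proof -
  have indep: "a = 0 \<and> b = 0" if "\<And>v. a * \<alpha> v + b * \<beta> v = 0" for a b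
    using assms that unfolding lin_indep_pair_def by blast
  show "\<alpha> \<noteq> (\<lambda>_. 0)"
    using indep[of 1 0] by auto
  show "(\<lambda>v. \<beta> v - c * \<alpha> v) \<noteq> (\<lambda>_. 0)"
    using indep[of "-c" 1] by (auto simp: fun_eq_iff)
qed

lemma not_lin_indep_pairE:
  assumes "\<not> lin_indep_pair \<alpha> \<beta>" "\<alpha> \<noteq> (\<lambda>_. 0)"
  obtains c where "\<beta> = (\<lambda>v. c * \<alpha> v)"
proof -
  obtain a b where ab: "\<forall>v. a * \<alpha> v + b * \<beta> v = 0" "\<not> (a = 0 \<and> b = 0)"
    using assms(1) unfolding lin_indep_pair_def by blast
  have "b \<noteq> 0"
    using ab assms(2) by (auto simp: fun_eq_iff)
  then have "\<beta> = (\<lambda>v. (- a / b) * \<alpha> v)"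
    using ab(1) by (auto simp: fun_eq_iff field_simps add_eq_0_iff)
  with that show thesis .
qed

text \<open>Stated for a single operator, so that it applies to the elements of the current
  one-parameter subgroup and to operators commuting with it. That the eigenvalues form a regular
  character is recovered only at the end.\<close>

definition weight_function :: "('v \<Rightarrow> 'v) \<Rightarrow> ('v \<Rightarrow> 'k::field) \<Rightarrow> bool" where
  "weight_function \<tau> \<alpha> \<longleftrightarrow> (\<exists>c. \<forall>v. \<alpha> (\<tau> v) = c * \<alpha> v)"


section \<open>Limits along one-parameter subgroups\<close>

text \<open>A rational representation of the multiplicative group, with \<open>\<sigma> s\<close>
  constrained only for nonzero \<open>s\<close>. The last assumption says that matrix coefficients
  are Laurent polynomials; the power \<open>s ^ N\<close> clears the denominator and may depend on
  \<open>\<alpha>\<close> and \<open>v\<close>.\<close>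

locale one_parameter_action = finite_dimensional_vector_space scale Basis
  for scale :: "'k::alg_closed_field \<Rightarrow> 'v::ab_group_add \<Rightarrow> 'v" and Basis +
  fixes \<sigma> :: "'k \<Rightarrow> 'v \<Rightarrow> 'v"
  assumes linear_action: "s \<noteq> 0 \<Longrightarrow> Vector_Spaces.linear scale scale (\<sigma> s)"
    and action_one: "\<sigma> 1 v = v"
    and action_mult: "r \<noteq> 0 \<Longrightarrow> s \<noteq> 0 \<Longrightarrow> \<sigma> (r * s) v = \<sigma> r (\<sigma> s v)"
    and laurent_action: "\<alpha> \<in> dual scale \<Longrightarrow> \<exists>N q. \<forall>s. s \<noteq> 0 \<longrightarrow> s ^ N * \<alpha> (\<sigma> s v) = poly q s"
begin

lemmas dual_iff = dual_iff[OF vector_space_axioms]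

text \<open>\<open>\<alpha>'\<close> is the leading coefficient of
  \<open>\<alpha> (\<sigma> s v)\<close> as \<open>s\<close> tends to 0. Since
  \<open>\<alpha>'\<close> is nonzero, \<open>m\<close> is the lowest exponent that occurs for any
  \<open>v\<close>; it may be negative.\<close>

definition initial_form :: "int \<Rightarrow> ('v \<Rightarrow> 'k) \<Rightarrow> ('v \<Rightarrow> 'k) \<Rightarrow> bool" where
  "initial_form m \<alpha> \<alpha>' \<longleftrightarrow> \<alpha>' \<noteq> (\<lambda>_. 0) \<and>
    (\<exists>q. \<forall>v. \<alpha>' v = poly (q v) 0 \<and> (\<forall>s. s \<noteq> 0 \<longrightarrow> \<alpha> (\<sigma> s v) = s powi m * poly (q v) s))"

lemma initial_formE:
  assumes "initial_form m \<alpha> \<alpha>'"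
  obtains q where "\<And>v. \<alpha>' v = poly (q v) 0"
    "\<And>s v. s \<noteq> 0 \<Longrightarrow> \<alpha> (\<sigma> s v) = s powi m * poly (q v) s"
  using assms unfolding initial_form_def by metis

section \<open>Existence, weights and independence of initial forms\<close>

lemma dual_comp_action: "\<alpha> \<in> dual scale \<Longrightarrow> s \<noteq> 0 \<Longrightarrow> (\<lambda>v. \<alpha> (\<sigma> s v)) \<in> dual scale"
  using linear_action[of s] by (simp add: dual_iff Vector_Spaces.linear_iff)

text \<open>Finite dimension bounds the pole orders at \<open>s = 0\<close> uniformly in
  \<open>v\<close>. After clearing denominators, the lowest power of \<open>s\<close> occurring for
  any \<open>v\<close> can be factored out.\<close>

lemma ex_initial_form:
  assumes \<alpha>: "\<alpha> \<in> dual scale" "\<alpha> \<noteq> (\<lambda>_. 0)"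
  shows "\<exists>m \<alpha>'. initial_form m \<alpha> \<alpha>'"
proof -
  have "\<forall>b. \<exists>N q. \<forall>s. s \<noteq> 0 \<longrightarrow> s ^ N * \<alpha> (\<sigma> s b) = poly q s"
    using laurent_action \<alpha>(1) by blast
  then obtain N q where Nq: "\<And>b s. s \<noteq> 0 \<Longrightarrow> s ^ N b * \<alpha> (\<sigma> s b) = poly (q b) s"
    by metis
  \<comment> \<open>The sum dominates each \<open>N b\<close>, so one power of \<open>s\<close>
    clears the denominators of all basis vectors, and then by linearity of all vectors.\<close>
  define M where "M = (\<Sum>b\<in>Basis. N b)"
  define good where "good v \<longleftrightarrow> (\<exists>p. \<forall>s. s \<noteq> 0 \<longrightarrow> s ^ M * \<alpha> (\<sigma> s v) = poly p s)" for v
  have add: "\<alpha> (\<sigma> s (v + w)) = \<alpha> (\<sigma> s v) + \<alpha> (\<sigma> s w)"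
    and hom: "\<alpha> (\<sigma> s (scale c v)) = c * \<alpha> (\<sigma> s v)" if "s \<noteq> 0" for s v w c
    using dual_comp_action[OF \<alpha>(1) that] by (simp_all add: dual_iff)
  have good_Basis: "good b" if "b \<in> Basis" for b
  proof -
    have "N b \<le> M"
      unfolding M_def using finite_Basis that by (intro member_le_sum) auto
    then have "s ^ M * \<alpha> (\<sigma> s b) = poly (monom 1 (M - N b) * q b) s" if "s \<noteq> 0" for s
      using Nq[OF that, of b, symmetric] by (simp add: poly_monom mult.assoc[symmetric] power_add[symmetric])
    then show ?thesis
      unfolding good_def by blast
  qed
  have "good v" for v
  proof (rule span_induct_alt[of v Basis good])
    show "v \<in> span Basis"
      using span_Basis by simp
    have "\<alpha> (\<sigma> s 0) = 0" if "s \<noteq> 0" for s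
      using hom[OF that, of 0 0] by simp
    then show "good 0"
      unfolding good_def by (intro exI[of _ 0]) simp
    fix c b w assume "b \<in> Basis" "good w"
    then obtain p p' where p: "\<forall>s. s \<noteq> 0 \<longrightarrow> s ^ M * \<alpha> (\<sigma> s b) = poly p s"
      and p': "\<forall>s. s \<noteq> 0 \<longrightarrow> s ^ M * \<alpha> (\<sigma> s w) = poly p' s"
      using good_Basis unfolding good_def by blast
    have "s ^ M * \<alpha> (\<sigma> s (scale c b + w)) = poly (smult c p + p') s" if "s \<noteq> 0" for s
      using p p' that by (simp add: add hom ring_distribs mult.left_commute)
    then show "good (scale c b + w)"
      unfolding good_def by blast
  qed
  then have "\<forall>v. \<exists>p. \<forall>s. s \<noteq> 0 \<longrightarrow> s ^ M * \<alpha> (\<sigma> s v) = poly p s"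
    by (simp add: good_def)
  then obtain p where p: "\<And>v s. s \<noteq> 0 \<Longrightarrow> s ^ M * \<alpha> (\<sigma> s v) = poly (p v) s"
    by metis
  obtain v0 where "\<alpha> v0 \<noteq> 0"
    using \<alpha>(2) by auto
  then have "p v0 \<noteq> 0"
    using p[of 1 v0] by (auto simp: action_one)
  then have ex: "\<exists>k v. coeff (p v) k \<noteq> 0"
    by (metis leading_coeff_0_iff)
  \<comment> \<open>The minimum is taken over all \<open>v\<close> together: every
    \<open>p v\<close> is divisible by the \<open>k\<close>-th power of \<open>s\<close>, and for
    some \<open>v\<close> the quotient has a nonzero constant term.\<close>
  define k where "k = (LEAST k. \<exists>v. coeff (p v) k \<noteq> 0)"
  have k: "\<exists>v. coeff (p v) k \<noteq> 0"
    unfolding k_def using ex by (rule LeastI_ex)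
  have less_k: "coeff (p v) j = 0" if "j < k" for j v
    using not_less_Least that unfolding k_def by blast
  have shift: "p v = monom 1 k * poly_shift k (p v)" for v
    by (rule poly_eqI) (auto simp: coeff_monom_mult coeff_poly_shift less_k)
  have "initial_form (int k - int M) \<alpha> (\<lambda>v. coeff (p v) k)"
    unfolding initial_form_def
  proof (intro conjI exI allI impI)
    show "(\<lambda>v. coeff (p v) k) \<noteq> (\<lambda>_. 0)"
      using k by (auto simp: fun_eq_iff)
    show "coeff (p v) k = poly (poly_shift k (p v)) 0" for v
      by (simp add: poly_0_coeff_0 coeff_poly_shift)
    fix v and s :: 'k assume s: "s \<noteq> 0"
    have "s ^ M * \<alpha> (\<sigma> s v) = s ^ k * poly (poly_shift k (p v)) s"
      using p[OF s, of v] shift[of v] by (metis poly_monom poly_mult mult_1)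
    then show "\<alpha> (\<sigma> s v) = s powi (int k - int M) * poly (poly_shift k (p v)) s"
      using s by (simp add: power_int_diff field_simps)
  qed
  then show ?thesis by blast
qed

text \<open>The polynomial \<open>q v\<close> is determined by its values at nonzero
  \<open>s\<close>, hence it depends linearly on \<open>v\<close>, and so does its value at
  0.\<close>

lemma initial_form_in_dual:
  assumes "\<alpha> \<in> dual scale" "initial_form m \<alpha> \<alpha>'"
  shows "\<alpha>' \<in> dual scale"
proof -
  obtain q where q0: "\<And>v. \<alpha>' v = poly (q v) 0"
    and q: "\<And>s v. s \<noteq> 0 \<Longrightarrow> \<alpha> (\<sigma> s v) = s powi m * poly (q v) s"
    using initial_formE[OF assms(2)] by blast
  have add: "\<alpha> (\<sigma> s (v + w)) = \<alpha> (\<sigma> s v) + \<alpha> (\<sigma> s w)"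
    and hom: "\<alpha> (\<sigma> s (scale c v)) = c * \<alpha> (\<sigma> s v)" if "s \<noteq> 0" for s v w c
    using dual_comp_action[OF assms(1) that] by (simp_all add: dual_iff)
  have "q (v + w) = q v + q w" for v w
  proof (rule poly_eqI_nonzero)
    fix s :: 'k assume s: "s \<noteq> 0"
    then have "s powi m * poly (q (v + w)) s = s powi m * poly (q v + q w) s"
      using add[OF s, of v w] by (simp add: q ring_distribs)
    then show "poly (q (v + w)) s = poly (q v + q w) s"
      using s by simp
  qed
  moreover have "q (scale c v) = smult c (q v)" for c v
  proof (rule poly_eqI_nonzero)
    fix s :: 'k assume s: "s \<noteq> 0"
    then have "s powi m * poly (q (scale c v)) s = s powi m * poly (smult c (q v)) s"
      using hom[OF s, of c v] by (simp add: q ac_simps)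
    then show "poly (q (scale c v)) s = poly (smult c (q v)) s"
      using s by simp
  qed
  ultimately show ?thesis
    by (simp add: dual_iff q0)
qed

text \<open>Moving \<open>v\<close> by \<open>\<sigma> r\<close> replaces \<open>s\<close> by
  \<open>s * r\<close> in the expansion: this contributes the factor \<open>r powi m\<close> and
  rescales the variable of \<open>q v\<close>, which has no effect at 0.\<close>

lemma initial_form_weight:
  assumes "initial_form m \<alpha> \<alpha>'" "r \<noteq> 0"
  shows "\<alpha>' (\<sigma> r v) = r powi m * \<alpha>' v"
proof -
  obtain q where q0: "\<And>v. \<alpha>' v = poly (q v) 0"
    and q: "\<And>s v. s \<noteq> 0 \<Longrightarrow> \<alpha> (\<sigma> s v) = s powi m * poly (q v) s"
    using initial_formE[OF assms(1)] by blast
  have "q (\<sigma> r v) = smult (r powi m) (pcompose (q v) [:0, r:])"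
  proof (rule poly_eqI_nonzero)
    fix s :: 'k assume s: "s \<noteq> 0"
    have "s powi m * poly (q (\<sigma> r v)) s = (s * r) powi m * poly (q v) (s * r)"
      using s assms(2) by (simp flip: q add: action_mult)
    then show "poly (q (\<sigma> r v)) s = poly (smult (r powi m) (pcompose (q v) [:0, r:])) s"
      using s by (simp add: power_int_mult_distrib poly_pcompose)
  qed
  then show ?thesis
    by (simp add: q0 poly_pcompose)
qed

text \<open>An eigenvalue equation that holds along the whole orbit passes to the limit. This
  preserves the weights obtained from coordinates treated earlier.\<close>

lemma initial_form_commuting:
  assumes "initial_form m \<alpha> \<alpha>'"
    and commute: "\<And>s v. s \<noteq> 0 \<Longrightarrow> \<sigma> s (\<tau> v) = \<tau> (\<sigma> s v)"
    and eigen: "\<And>v. \<alpha> (\<tau> v) = c * \<alpha> v"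
  shows "\<alpha>' (\<tau> v) = c * \<alpha>' v"
proof -
  obtain q where q0: "\<And>v. \<alpha>' v = poly (q v) 0"
    and q: "\<And>s v. s \<noteq> 0 \<Longrightarrow> \<alpha> (\<sigma> s v) = s powi m * poly (q v) s"
    using initial_formE[OF assms(1)] by blast
  have "q (\<tau> v) = smult c (q v)"
  proof (rule poly_eqI_nonzero)
    fix s :: 'k assume s: "s \<noteq> 0"
    have "s powi m * poly (q (\<tau> v)) s = c * (s powi m * poly (q v) s)"
      using s by (simp flip: q add: commute eigen)
    then show "poly (q (\<tau> v)) s = poly (smult c (q v)) s"
      using s by simp
  qed
  then show ?thesis
    by (simp add: q0)
qed

text \<open>Proportional nonzero functions would have the same eigenvalues, but the characters with
  exponents \<open>m\<close> and \<open>n\<close> differ.\<close>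

lemma lin_indep_initial_forms:
  assumes "initial_form m \<alpha> \<alpha>'" "initial_form n \<beta> \<beta>'" "m \<noteq> n"
  shows "lin_indep_pair \<alpha>' \<beta>'"
proof (rule ccontr)
  assume "\<not> lin_indep_pair \<alpha>' \<beta>'"
  moreover have "\<alpha>' \<noteq> (\<lambda>_. 0)" "\<beta>' \<noteq> (\<lambda>_. 0)"
    using assms by (simp_all add: initial_form_def)
  ultimately obtain c where c: "\<beta>' = (\<lambda>v. c * \<alpha>' v)"
    using not_lin_indep_pairE by blast
  obtain v where v: "\<beta>' v \<noteq> 0"
    using \<open>\<beta>' \<noteq> (\<lambda>_. 0)\<close> by auto
  have "r powi m = r powi n" if "r \<noteq> 0" for r :: 'k
  proof -
    have "r powi n * \<beta>' v = r powi m * \<beta>' v"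
      using initial_form_weight[OF assms(1) that, of v] initial_form_weight[OF assms(2) that, of v]
      by (auto simp: c)
    with v show ?thesis by simp
  qed
  with assms(3) show False
    using power_int_eq_imp_exponent_eq by blast
qed

text \<open>The initial forms of two independent functions may be proportional; subtracting a multiple
  then cancels them, and the initial form of the difference has a different weight.\<close>

lemma ex_lin_indep_initial_forms:
  assumes \<alpha>: "\<alpha> \<in> dual scale" and \<beta>: "\<beta> \<in> dual scale" and indep: "lin_indep_pair \<alpha> \<beta>"
  obtains c m n \<alpha>' \<beta>' where
    "initial_form m \<alpha> \<alpha>'" "initial_form n (\<lambda>v. \<beta> v - c * \<alpha> v) \<beta>'" "lin_indep_pair \<alpha>' \<beta>'"
    "c \<noteq> 0 \<longrightarrow> initial_form m \<beta> (\<lambda>v. c * \<alpha>' v)"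
proof -
  obtain m \<alpha>' where in_\<alpha>: "initial_form m \<alpha> \<alpha>'"
    using ex_initial_form[OF \<alpha>] lin_indep_pair_nonzero(1)[OF indep] by blast
  obtain n \<beta>' where in_\<beta>: "initial_form n \<beta> \<beta>'"
    using ex_initial_form[OF \<beta>] lin_indep_pair_nonzero(2)[OF indep, of 0] by auto
  show thesis
  proof (cases "lin_indep_pair \<alpha>' \<beta>'")
    \<comment> \<open>Nothing has to be subtracted: with \<open>c = 0\<close> the last claim is
      vacuous.\<close>
    case True
    with in_\<alpha> in_\<beta> show thesis
      by (intro that[of m \<alpha>' n 0 \<beta>']) simp_all
  next
    case False
    then have "m = n"
      using lin_indep_initial_forms[OF in_\<alpha> in_\<beta>] by blast
    obtain c where c: "\<beta>' = (\<lambda>v. c * \<alpha>' v)"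
      using not_lin_indep_pairE[OF False] in_\<alpha> by (auto simp: initial_form_def)
    define \<gamma> where "\<gamma> = (\<lambda>v. \<beta> v - c * \<alpha> v)"
    have "\<gamma> \<in> dual scale"
      using \<alpha> \<beta> by (simp add: dual_iff \<gamma>_def algebra_simps)
    then obtain l \<gamma>' where in_\<gamma>: "initial_form l \<gamma> \<gamma>'"
      using ex_initial_form lin_indep_pair_nonzero(2)[OF indep, of c] unfolding \<gamma>_def by blast
    \<comment> \<open>If the exponents agreed, the leading coefficient of \<open>\<gamma>\<close>
      would be \<open>\<beta>' - c \<alpha>'\<close>, which vanishes by the choice of
      \<open>c\<close>.\<close>
    have "m \<noteq> l"
    proof
      assume "m = l"
      obtain p where p0: "\<And>v. \<alpha>' v = poly (p v) 0"
        and p: "\<And>s v. s \<noteq> 0 \<Longrightarrow> \<alpha> (\<sigma> s v) = s powi m * poly (p v) s"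
        using initial_formE[OF in_\<alpha>] by blast
      obtain q where q0: "\<And>v. \<beta>' v = poly (q v) 0"
        and q: "\<And>s v. s \<noteq> 0 \<Longrightarrow> \<beta> (\<sigma> s v) = s powi m * poly (q v) s"
        using initial_formE[OF in_\<beta>] \<open>m = n\<close> by blast
      obtain g where g0: "\<And>v. \<gamma>' v = poly (g v) 0"
        and g: "\<And>s v. s \<noteq> 0 \<Longrightarrow> \<gamma> (\<sigma> s v) = s powi m * poly (g v) s"
        using initial_formE[OF in_\<gamma>] \<open>m = l\<close> by blast
      have "g v = q v - smult c (p v)" for v
      proof (rule poly_eqI_nonzero)
        fix s :: 'k assume s: "s \<noteq> 0"
        have "s powi m * poly (g v) s = s powi m * poly (q v - smult c (p v)) s"
          using s by (simp flip: g p q add: \<gamma>_def right_diff_distrib mult.left_commute[of "s powi m"])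
        then show "poly (g v) s = poly (q v - smult c (p v)) s"
          using s by simp
      qed
      then have "\<gamma>' v = \<beta>' v - c * \<alpha>' v" for v
        by (simp add: p0 q0 g0)
      then have "\<gamma>' = (\<lambda>_. 0)"
        by (simp add: c fun_eq_iff)
      then show False
        using in_\<gamma> by (simp add: initial_form_def)
    qed
    then have "lin_indep_pair \<alpha>' \<gamma>'"
      by (rule lin_indep_initial_forms[OF in_\<alpha> in_\<gamma>])
    then show thesis
      using that[OF in_\<alpha>] in_\<gamma> in_\<beta> \<open>m = n\<close> unfolding \<gamma>_def c by blast
  qed
qed

text \<open>Bihomogeneity pulls the powers of \<open>s\<close> out of \<open>p\<close>. What remains
  is a polynomial in \<open>s\<close> that vanishes at nonzero \<open>s\<close>, hence also at 0: a
  closed set contains the limit of an orbit.\<close>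

lemma bihomogeneous_initial_form:
  assumes p: "bihomogeneous d e p"
    and in_\<alpha>: "initial_form m \<alpha> \<alpha>'" and in_\<beta>: "initial_form n \<beta> \<beta>'"
    and van: "\<And>s. s \<noteq> 0 \<Longrightarrow> p (\<lambda>v. \<alpha> (\<sigma> s v)) (\<lambda>v. \<beta> (\<sigma> s v)) = 0"
  shows "p \<alpha>' \<beta>' = 0"
proof -
  obtain f where f0: "\<And>v. \<alpha>' v = poly (f v) 0"
    and f: "\<And>s v. s \<noteq> 0 \<Longrightarrow> \<alpha> (\<sigma> s v) = s powi m * poly (f v) s"
    using initial_formE[OF in_\<alpha>] by blast
  obtain g where g0: "\<And>v. \<beta>' v = poly (g v) 0"
    and g: "\<And>s v. s \<noteq> 0 \<Longrightarrow> \<beta> (\<sigma> s v) = s powi n * poly (g v) s"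
    using initial_formE[OF in_\<beta>] by blast
  obtain q where q: "\<And>s. p (\<lambda>v. poly (f v) s) (\<lambda>v. poly (g v) s) = poly q s"
    using bihomogeneous_poly[OF p, of f g] by blast
  have "q = 0"
  proof (rule poly_eqI_nonzero)
    fix s :: 'k assume s: "s \<noteq> 0"
    then have "(s powi m) ^ d * (s powi n) ^ e * poly q s = 0"
      using van[OF s] by (simp add: f g bihomogeneous_scale[OF p] q)
    then show "poly q s = poly 0 s"
      using s by simp
  qed
  moreover have "\<alpha>' = (\<lambda>v. poly (f v) 0)" "\<beta>' = (\<lambda>v. poly (g v) 0)"
    by (simp_all add: fun_eq_iff f0 g0)
  ultimately show ?thesis
    by (simp add: q)
qed

text \<open>The treatment of one coordinate: the moved pairs stay in the characteristic variety
  because \<open>X\<close> is invariant, so closedness puts the limit pair there too. The last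
  conclusion carries earlier weights through the induction over the coordinates.\<close>

lemma ex_limit_pair:
  assumes closed: "zariski_closed scale (char_variety scale X)"
    and invariant: "\<And>s x. s \<noteq> 0 \<Longrightarrow> x \<in> X \<Longrightarrow> \<sigma> s x \<in> X"
    and \<alpha>: "\<alpha> \<in> dual scale" and \<beta>: "\<beta> \<in> dual scale" and indep: "lin_indep_pair \<alpha> \<beta>"
    and van: "\<forall>x\<in>X. \<alpha> x = 0 \<longrightarrow> \<beta> x = 0"
  obtains \<alpha>' \<beta>' where
    "\<alpha>' \<in> dual scale" "\<beta>' \<in> dual scale" "lin_indep_pair \<alpha>' \<beta>'"
    "\<forall>x\<in>X. \<alpha>' x = 0 \<longrightarrow> \<beta>' x = 0"
    "\<forall>r. r \<noteq> 0 \<longrightarrow> weight_function (\<sigma> r) \<alpha>' \<and> weight_function (\<sigma> r) \<beta>'"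
    "\<forall>\<tau>. (\<forall>s v. s \<noteq> 0 \<longrightarrow> \<sigma> s (\<tau> v) = \<tau> (\<sigma> s v)) \<longrightarrow>
      weight_function \<tau> \<alpha> \<longrightarrow> weight_function \<tau> \<beta> \<longrightarrow> weight_function \<tau> \<alpha>' \<and> weight_function \<tau> \<beta>'"
proof -
  obtain c m n \<alpha>' \<beta>' where in_\<alpha>: "initial_form m \<alpha> \<alpha>'"
    and in_\<gamma>: "initial_form n (\<lambda>v. \<beta> v - c * \<alpha> v) \<beta>'"
    and indep': "lin_indep_pair \<alpha>' \<beta>'"
    and in_\<beta>: "c \<noteq> 0 \<longrightarrow> initial_form m \<beta> (\<lambda>v. c * \<alpha>' v)"
    by (rule ex_lin_indep_initial_forms[OF \<alpha> \<beta> indep])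
  define \<gamma> where "\<gamma> = (\<lambda>v. \<beta> v - c * \<alpha> v)"
  note in_\<gamma> = in_\<gamma>[folded \<gamma>_def]
  have \<gamma>: "\<gamma> \<in> dual scale"
    using \<alpha> \<beta> by (simp add: dual_iff \<gamma>_def algebra_simps)
  have \<alpha>': "\<alpha>' \<in> dual scale - {\<lambda>_. 0}" and \<beta>': "\<beta>' \<in> dual scale - {\<lambda>_. 0}"
    using initial_form_in_dual[OF \<alpha> in_\<alpha>] initial_form_in_dual[OF \<gamma> in_\<gamma>] in_\<alpha> in_\<gamma>
    by (simp_all add: initial_form_def)
  obtain F where F: "\<And>p. p \<in> F \<Longrightarrow> \<exists>d e. bihomogeneous d e p"
    and F_iff: "\<And>\<alpha> \<beta>. \<alpha> \<in> dual scale - {\<lambda>_. 0} \<Longrightarrow> \<beta> \<in> dual scale - {\<lambda>_. 0} \<Longrightarrow>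
      (proj_pt \<alpha>, proj_pt \<beta>) \<in> char_variety scale X \<longleftrightarrow> (\<forall>p\<in>F. p \<alpha> \<beta> = 0)"
    using zariski_closedE[OF closed] by blast
  \<comment> \<open>\<open>\<sigma> s\<close> is surjective, with right inverse
    \<open>\<sigma> (inverse s)\<close>, so composing with it kills no nonzero function.\<close>
  have nonzero: "(\<lambda>v. \<delta> (\<sigma> s v)) \<noteq> (\<lambda>_. 0)" if "\<delta> \<noteq> (\<lambda>_. 0)" "s \<noteq> 0" for \<delta> :: "'v \<Rightarrow> 'k" and s
  proof
    assume "(\<lambda>v. \<delta> (\<sigma> s v)) = (\<lambda>_. 0)"
    then have "\<delta> (\<sigma> s (\<sigma> (inverse s) v)) = 0" for v
      by meson
    moreover have "\<sigma> s (\<sigma> (inverse s) v) = v" for v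
      using action_mult[of s "inverse s" v] that(2) by (simp add: action_one)
    ultimately have "\<delta> v = 0" for v
      by simp
    with that(1) show False by auto
  qed
  have "p \<alpha>' \<beta>' = 0" if pF: "p \<in> F" for p
  proof -
    obtain d e where "bihomogeneous d e p"
      using F[OF pF] by blast
    moreover have "p (\<lambda>v. \<alpha> (\<sigma> s v)) (\<lambda>v. \<gamma> (\<sigma> s v)) = 0" if s: "s \<noteq> 0" for s
    proof -
      have "(\<lambda>v. \<alpha> (\<sigma> s v)) \<in> dual scale - {\<lambda>_. 0}" "(\<lambda>v. \<gamma> (\<sigma> s v)) \<in> dual scale - {\<lambda>_. 0}"
        using dual_comp_action[OF \<alpha> s] dual_comp_action[OF \<gamma> s]
          nonzero[OF lin_indep_pair_nonzero(1)[OF indep] s]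
          nonzero[OF lin_indep_pair_nonzero(2)[OF indep, of c, folded \<gamma>_def] s] by auto
      moreover have "\<forall>x\<in>X. \<alpha> (\<sigma> s x) = 0 \<longrightarrow> \<gamma> (\<sigma> s x) = 0"
        using van invariant[OF s] by (simp add: \<gamma>_def)
      ultimately show ?thesis
        using char_variety_iff F_iff pF by blast
    qed
    ultimately show ?thesis
      using bihomogeneous_initial_form[OF _ in_\<alpha> in_\<gamma>] by blast
  qed
  then have van': "\<forall>x\<in>X. \<alpha>' x = 0 \<longrightarrow> \<beta>' x = 0"
    using char_variety_iff[OF \<alpha>' \<beta>'] F_iff[OF \<alpha>' \<beta>'] by blast
  have weights: "weight_function (\<sigma> r) \<alpha>' \<and> weight_function (\<sigma> r) \<beta>'" if "r \<noteq> 0" for r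
    using initial_form_weight[OF in_\<alpha> that] initial_form_weight[OF in_\<gamma> that]
    unfolding weight_function_def by blast
  have "weight_function \<tau> \<alpha>' \<and> weight_function \<tau> \<beta>'"
    if commute: "\<And>s v. s \<noteq> 0 \<Longrightarrow> \<sigma> s (\<tau> v) = \<tau> (\<sigma> s v)"
      and w: "weight_function \<tau> \<alpha>" "weight_function \<tau> \<beta>" for \<tau>
  proof -
    obtain a b where a: "\<And>v. \<alpha> (\<tau> v) = a * \<alpha> v" and b: "\<And>v. \<beta> (\<tau> v) = b * \<beta> v"
      using w unfolding weight_function_def by blast
    have a': "\<alpha>' (\<tau> v) = a * \<alpha>' v" for v
      using in_\<alpha> commute a by (rule initial_form_commuting)
    \<comment> \<open>Subtracting \<open>c \<alpha>\<close> keeps an eigenvector only if the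
      eigenvalues agree. They do when \<open>c\<close> is nonzero: then \<open>c \<alpha>'\<close>
      is the initial form of \<open>\<beta>\<close>, so \<open>\<alpha>'\<close> has both
      eigenvalues \<open>a\<close> and \<open>b\<close>.\<close>
    have "\<gamma> (\<tau> v) = b * \<gamma> v" for v
    proof (cases "c = 0")
      case True
      then show ?thesis by (simp add: \<gamma>_def b)
    next
      case False
      obtain w where w: "\<alpha>' w \<noteq> 0"
        using \<alpha>' by auto
      have "c * \<alpha>' (\<tau> w) = b * (c * \<alpha>' w)"
        using in_\<beta>[rule_format, OF False] commute b by (rule initial_form_commuting)
      then have "a = b"
        using w False by (simp add: a')
      then show ?thesis
        by (simp add: \<gamma>_def a b algebra_simps)
    qed
    then have "\<beta>' (\<tau> v) = b * \<beta>' v" for v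
      using initial_form_commuting[OF in_\<gamma> commute] by blast
    with a' show ?thesis
      unfolding weight_function_def by blast
  qed
  then have commuting: "\<forall>\<tau>. (\<forall>s v. s \<noteq> 0 \<longrightarrow> \<sigma> s (\<tau> v) = \<tau> (\<sigma> s v)) \<longrightarrow>
      weight_function \<tau> \<alpha> \<longrightarrow> weight_function \<tau> \<beta> \<longrightarrow> weight_function \<tau> \<alpha>' \<and> weight_function \<tau> \<beta>'"
    by simp
  show thesis
    by (rule that[OF _ _ indep' van' _ commuting]) (use \<alpha>' \<beta>' weights in simp_all)
qed

end


section \<open>Torus representations\<close>

lemma carrier_Gm [simp]: "carrier Gm = - {0}"
  and mult_Gm [simp]: "x \<otimes>\<^bsub>Gm\<^esub> y = x * y"
  and one_Gm [simp]: "\<one>\<^bsub>Gm\<^esub> = 1"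
  by (simp_all add: Gm_def)

lemma group_Gm: "group (Gm :: 'k::field monoid)"
proof (rule groupI)
  show "\<exists>y\<in>carrier Gm. y \<otimes>\<^bsub>Gm\<^esub> x = \<one>\<^bsub>Gm\<^esub>" if "x \<in> carrier Gm" for x :: 'k
    using that by (intro bexI[of _ "inverse x"]) auto
qed auto

lemma inv_Gm: "x \<noteq> 0 \<Longrightarrow> inv\<^bsub>Gm\<^esub> x = inverse x"
  by (rule group.inv_equality[OF group_Gm]) simp_all

lemma group_Gm_power: "group (Gm_power n)"
  unfolding Gm_power_def by (simp add: group_Gm)

lemma inv_Gm_power:
  "u \<in> carrier (Gm_power n) \<Longrightarrow> inv\<^bsub>Gm_power n\<^esub> u = (\<lambda>i\<in>{..<n}. inverse (u i))"
  unfolding Gm_power_def by (auto simp: group_Gm inv_Gm PiE_iff intro!: restrict_ext)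

text \<open>The restriction makes the tuple extensional, as the carrier of
  \<open>product_group\<close> demands.\<close>

definition coordinate_element :: "nat \<Rightarrow> nat \<Rightarrow> 'k::field \<Rightarrow> nat \<Rightarrow> 'k" where
  "coordinate_element n i s = (\<lambda>j\<in>{..<n}. if j = i then s else 1)"

lemma coordinate_element_carrier: "s \<noteq> 0 \<Longrightarrow> coordinate_element n i s \<in> carrier (Gm_power n)"
  by (simp add: coordinate_element_def Gm_power_def)

lemma coordinate_element_one: "coordinate_element n i 1 = \<one>\<^bsub>Gm_power n\<^esub>"
  by (auto simp: coordinate_element_def Gm_power_def)

lemma coordinate_element_mult:
  "coordinate_element n i (r * s) =
    coordinate_element n i r \<otimes>\<^bsub>Gm_power n\<^esub> coordinate_element n i s"
  by (auto simp: coordinate_element_def Gm_power_def)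

lemma weight_function_comp:
  assumes "weight_function f \<alpha>" "weight_function g \<alpha>"
  shows "weight_function (\<lambda>v. f (g v)) \<alpha>"
  using assms unfolding weight_function_def by (metis mult.assoc)

locale torus_representation = finite_dimensional_vector_space scale Basis
  for scale :: "'k::alg_closed_field \<Rightarrow> 'v::ab_group_add \<Rightarrow> 'v" and Basis +
  fixes T :: "('t, 'm) monoid_scheme" and R :: "('t \<Rightarrow> 'k) set"
    and \<rho> :: "'t \<Rightarrow> 'v \<Rightarrow> 'v" and n :: nat and \<phi> :: "'t \<Rightarrow> nat \<Rightarrow> 'k"
  assumes group_T: "group T" and iso: "\<phi> \<in> iso T (Gm_power n)"
    and R_def: "R = {f. \<exists>g \<in> laurent_functions n. \<forall>t \<in> carrier T. f t = g (\<phi> t)}"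
    and representation: "rational_representation T R scale \<rho>"
begin

section \<open>Transport between the torus and its coordinates\<close>

interpretation T: group T by (rule group_T)

lemmas dual_iff = dual_iff[OF vector_space_axioms]

definition \<psi> where "\<psi> = inv_into (carrier T) \<phi>"

lemma \<psi>_iso: "\<psi> \<in> iso (Gm_power n) T"
  unfolding \<psi>_def by (rule T.iso_set_sym[OF iso])

lemma \<psi>_carrier: "u \<in> carrier (Gm_power n) \<Longrightarrow> \<psi> u \<in> carrier T"
  using \<psi>_iso by (auto simp: iso_def hom_def)

lemma \<psi>_mult:
  "u \<in> carrier (Gm_power n) \<Longrightarrow> w \<in> carrier (Gm_power n) \<Longrightarrow>
    \<psi> (u \<otimes>\<^bsub>Gm_power n\<^esub> w) = \<psi> u \<otimes>\<^bsub>T\<^esub> \<psi> w"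
  using \<psi>_iso by (auto simp: iso_def hom_def)

lemma \<psi>_one: "\<psi> \<one>\<^bsub>Gm_power n\<^esub> = \<one>\<^bsub>T\<^esub>"
  using \<psi>_iso hom_one[OF _ group_Gm_power group_T] by (auto simp: iso_def)

lemma \<phi>_carrier: "t \<in> carrier T \<Longrightarrow> \<phi> t \<in> carrier (Gm_power n)"
  using iso by (auto simp: iso_def hom_def)

lemma \<psi>_\<phi>: "t \<in> carrier T \<Longrightarrow> \<psi> (\<phi> t) = t"
  unfolding \<psi>_def using iso by (auto simp: iso_def bij_betw_def)

lemma \<phi>_\<psi>: "u \<in> carrier (Gm_power n) \<Longrightarrow> \<phi> (\<psi> u) = u"
  unfolding \<psi>_def using iso by (auto simp: iso_def bij_betw_def intro: f_inv_into_f)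

lemma T_commute:
  assumes "s \<in> carrier T" "t \<in> carrier T"
  shows "s \<otimes>\<^bsub>T\<^esub> t = t \<otimes>\<^bsub>T\<^esub> s"
proof -
  have "\<phi> s \<otimes>\<^bsub>Gm_power n\<^esub> \<phi> t = \<phi> t \<otimes>\<^bsub>Gm_power n\<^esub> \<phi> s"
    by (simp add: Gm_power_def mult.commute)
  then show ?thesis
    using \<psi>_mult[OF \<phi>_carrier \<phi>_carrier] assms by (metis \<psi>_\<phi>)
qed

lemma action: "group_action T UNIV \<rho>"
  and linear: "t \<in> carrier T \<Longrightarrow> Vector_Spaces.linear scale scale (\<rho> t)"
  and matrix_coefficient: "\<alpha> \<in> dual scale \<Longrightarrow> (\<lambda>t. \<alpha> (\<rho> t v)) \<in> R"
  using representation by (auto simp: rational_representation_def)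

lemma \<rho>_mult: "s \<in> carrier T \<Longrightarrow> t \<in> carrier T \<Longrightarrow> \<rho> (s \<otimes>\<^bsub>T\<^esub> t) v = \<rho> s (\<rho> t v)"
  by (rule group_action.composition_rule[OF action]) auto

lemma \<rho>_one: "\<rho> \<one>\<^bsub>T\<^esub> v = v"
  using group_action.id_eq_one[OF action] by (metis UNIV_I restrict_apply')

lemma \<rho>_commute: "s \<in> carrier T \<Longrightarrow> t \<in> carrier T \<Longrightarrow> \<rho> s (\<rho> t v) = \<rho> t (\<rho> s v)"
  by (metis \<rho>_mult T_commute)

text \<open>Inversion negates the exponents of a Laurent polynomial. It is needed because the dual
  action, and hence the character of a semiinvariant, involves inverses.\<close>

lemma R_inv:
  assumes "f \<in> R"
  shows "(\<lambda>t. f (inv\<^bsub>T\<^esub> t)) \<in> R"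
proof -
  obtain E :: "(nat \<Rightarrow> int) set" and c where "finite E"
    and f: "\<And>t. t \<in> carrier T \<Longrightarrow> f t = (\<Sum>e\<in>E. c e * (\<Prod>i<n. \<phi> t i powi e i))"
    using assms \<phi>_carrier unfolding R_def laurent_functions_def by auto
  define neg :: "(nat \<Rightarrow> int) \<Rightarrow> nat \<Rightarrow> int" where "neg e = (\<lambda>i. - e i)" for e
  have neg_neg: "neg (neg e) = e" for e
    by (simp add: neg_def)
  \<comment> \<open>\<open>neg\<close> is an involution, so summing over its image with coefficients
    \<open>c (neg e)\<close> is a mere reindexing.\<close>
  define g where "g u = (\<Sum>e\<in>neg ` E. c (neg e) * (\<Prod>i<n. u i powi e i))" for u :: "nat \<Rightarrow> 'k"
  have "g \<in> laurent_functions n"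
    unfolding laurent_functions_def
    by (intro CollectI exI[of _ "neg ` E"] exI[of _ "\<lambda>e. c (neg e)"])
      (simp add: g_def \<open>finite E\<close>)
  moreover have "f (inv\<^bsub>T\<^esub> t) = g (\<phi> t)" if t: "t \<in> carrier T" for t
  proof -
    have "\<phi> (inv\<^bsub>T\<^esub> t) = inv\<^bsub>Gm_power n\<^esub> \<phi> t"
      using iso t by (intro group_hom.hom_inv)
        (auto simp: iso_def group_hom_def group_hom_axioms_def group_Gm_power group_T)
    then have "\<phi> (inv\<^bsub>T\<^esub> t) i powi e i = \<phi> t i powi (- e i)" if "i < n" for i and e :: "nat \<Rightarrow> int"
      using that inv_Gm_power[OF \<phi>_carrier[OF t]] by (simp add: power_int_minus power_int_inverse)
    then have "f (inv\<^bsub>T\<^esub> t) = (\<Sum>e\<in>E. c e * (\<Prod>i<n. \<phi> t i powi (- e i)))"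
      using t by (simp add: f)
    also have "\<dots> = g (\<phi> t)"
      unfolding g_def by (subst sum.reindex) (auto intro: inj_on_inverseI neg_neg simp: neg_neg neg_def)
    finally show ?thesis .
  qed
  ultimately show ?thesis
    unfolding R_def by blast
qed

text \<open>A matrix coefficient is a Laurent polynomial in all coordinates; on this subgroup the
  coordinates other than the \<open>i\<close>-th are 1, which leaves a Laurent polynomial in
  \<open>s\<close>.\<close>

lemma one_parameter_action_coordinate:
  assumes i: "i < n"
  shows "one_parameter_action scale Basis (\<lambda>s. \<rho> (\<psi> (coordinate_element n i s)))"
proof (intro one_parameter_action.intro one_parameter_action_axioms.intro)
  fix \<alpha> v assume "\<alpha> \<in> dual scale"
  then obtain E :: "(nat \<Rightarrow> int) set" and c where "finite E"
    and E: "\<And>t. t \<in> carrier T \<Longrightarrow> \<alpha> (\<rho> t v) = (\<Sum>e\<in>E. c e * (\<Prod>j<n. \<phi> t j powi e j))"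
    using matrix_coefficient[of \<alpha> v] \<phi>_carrier unfolding R_def laurent_functions_def by auto
  \<comment> \<open>\<open>N\<close> is at least \<open>- e i\<close> for each \<open>e\<close> in
    \<open>E\<close>, so \<open>nat\<close> truncates nothing in the exponents of
    \<open>q\<close>.\<close>
  define N where "N = (\<Sum>e\<in>E. nat (- e i))"
  define q where "q = (\<Sum>e\<in>E. monom (c e) (nat (int N + e i)))"
  have "s ^ N * \<alpha> (\<rho> (\<psi> (coordinate_element n i s)) v) = poly q s" if s: "s \<noteq> 0" for s
  proof -
    have "(\<Prod>j<n. coordinate_element n i s j powi e j) = s powi e i" for e :: "nat \<Rightarrow> int"
    proof -
      have "(\<Prod>j<n. coordinate_element n i s j powi e j) = (\<Prod>j<n. if j = i then s powi e i else 1)"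
        by (rule prod.cong) (auto simp: coordinate_element_def)
      with i show ?thesis by simp
    qed
    then have "\<alpha> (\<rho> (\<psi> (coordinate_element n i s)) v) = (\<Sum>e\<in>E. c e * s powi e i)"
      using s by (simp add: E \<psi>_carrier \<phi>_\<psi> coordinate_element_carrier)
    moreover have "s ^ N * s powi e i = s ^ nat (int N + e i)" if "e \<in> E" for e
    proof -
      have "nat (- e i) \<le> N"
        unfolding N_def using \<open>finite E\<close> that by (intro member_le_sum) auto
      then have "s ^ nat (int N + e i) = s powi (int N + e i)"
        by (simp add: power_int_nonneg_exp)
      with s show ?thesis
        by (simp add: power_int_add)
    qed
    ultimately show ?thesis
      by (simp add: q_def poly_sum poly_monom sum_distrib_left mult.left_commute[of "s ^ N"])
  qed
  then show "\<exists>N q. \<forall>s. s \<noteq> 0 \<longrightarrow> s ^ N * \<alpha> (\<rho> (\<psi> (coordinate_element n i s)) v) = poly q s"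
    by blast
qed (simp_all add: finite_dimensional_vector_space_axioms linear \<psi>_carrier \<psi>_one \<psi>_mult \<rho>_one \<rho>_mult
      coordinate_element_carrier coordinate_element_one coordinate_element_mult)

text \<open>Every torus element is a product of coordinate elements, and a common eigenvector of
  operators is an eigenvector of their composition.\<close>

lemma weight_function_torus:
  assumes coord: "\<And>i s. i < n \<Longrightarrow> s \<noteq> 0 \<Longrightarrow> weight_function (\<rho> (\<psi> (coordinate_element n i s))) \<alpha>"
    and t: "t \<in> carrier T"
  shows "weight_function (\<rho> t) \<alpha>"
proof -
  have nonzero: "\<phi> t i \<noteq> 0" if "i < n" for i
    using \<phi>_carrier[OF t] that by (auto simp: Gm_power_def PiE_iff)
  \<comment> \<open>The partial products: \<open>trunc\<close> leads from the unit at 0 to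
    \<open>\<phi> t\<close> at \<open>n\<close>, gaining one coordinate element at a time.\<close>
  define trunc where "trunc k = (\<lambda>j\<in>{..<n}. if j < k then \<phi> t j else 1)" for k
  have carrier: "trunc k \<in> carrier (Gm_power n)" for k
    using nonzero by (auto simp: trunc_def Gm_power_def)
  have "k \<le> n \<Longrightarrow> weight_function (\<rho> (\<psi> (trunc k))) \<alpha>" for k
  proof (induction k)
    case 0
    have "trunc 0 = \<one>\<^bsub>Gm_power n\<^esub>"
      by (auto simp: trunc_def Gm_power_def)
    then show ?case
      unfolding weight_function_def by (intro exI[of _ 1]) (simp add: \<psi>_one \<rho>_one)
  next
    case (Suc k)
    let ?c = "coordinate_element n k (\<phi> t k)"
    have c: "?c \<in> carrier (Gm_power n)"
      using Suc.prems nonzero by (simp add: coordinate_element_carrier)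
    have "trunc (Suc k) = trunc k \<otimes>\<^bsub>Gm_power n\<^esub> ?c"
      by (auto simp: trunc_def coordinate_element_def Gm_power_def less_Suc_eq)
    then have "\<rho> (\<psi> (trunc (Suc k))) = (\<lambda>v. \<rho> (\<psi> (trunc k)) (\<rho> (\<psi> ?c) v))"
      using carrier c by (intro ext) (simp add: \<psi>_mult \<rho>_mult \<psi>_carrier)
    moreover have "weight_function (\<rho> (\<psi> ?c)) \<alpha>"
      using Suc.prems nonzero by (intro coord) auto
    ultimately show ?case
      using Suc weight_function_comp[of "\<rho> (\<psi> (trunc k))" \<alpha> "\<rho> (\<psi> ?c)"] by simp
  qed
  moreover have "trunc n = \<phi> t"
    using \<phi>_carrier[OF t] by (auto simp: trunc_def Gm_power_def PiE_iff extensional_def)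
  ultimately show ?thesis
    using \<psi>_\<phi>[OF t] by (metis order_refl)
qed

text \<open>Evaluating at a vector where \<open>\<alpha>\<close> is 1 exhibits the eigenvalue as a
  matrix coefficient composed with inversion, hence as a regular function.\<close>

lemma semiinvariantI:
  assumes \<alpha>: "\<alpha> \<in> dual scale" "\<alpha> \<noteq> (\<lambda>_. 0)"
    and weight: "\<And>t. t \<in> carrier T \<Longrightarrow> weight_function (\<rho> t) \<alpha>"
  shows "semiinvariant T R scale \<rho> \<alpha>"
proof -
  obtain w where "\<alpha> w \<noteq> 0"
    using \<alpha>(2) by auto
  define v0 where "v0 = scale (1 / \<alpha> w) w"
  have v0: "\<alpha> v0 = 1"
    using \<alpha>(1) \<open>\<alpha> w \<noteq> 0\<close> by (simp add: dual_iff v0_def)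
  define \<chi> where "\<chi> t = \<alpha> (\<rho> (inv\<^bsub>T\<^esub> t) v0)" for t
  have \<chi>: "\<alpha> (\<rho> (inv\<^bsub>T\<^esub> t) v) = \<chi> t * \<alpha> v" if t: "t \<in> carrier T" for t v
  proof -
    obtain c where "\<And>v. \<alpha> (\<rho> (inv\<^bsub>T\<^esub> t) v) = c * \<alpha> v"
      using weight[of "inv\<^bsub>T\<^esub> t"] t unfolding weight_function_def by auto
    then show ?thesis
      by (simp add: \<chi>_def v0)
  qed
  have "\<chi> \<in> R"
    unfolding \<chi>_def using R_inv[OF matrix_coefficient[OF \<alpha>(1)]] .
  moreover have "\<chi> \<in> hom T Gm"
  proof (rule homI)
    fix t assume t: "t \<in> carrier T"
    \<comment> \<open>Moving \<open>v0\<close> by \<open>t\<close> and back gives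
      \<open>\<alpha> v0 = 1\<close>, so the eigenvalue is invertible.\<close>
    have "\<chi> t * \<alpha> (\<rho> t v0) = 1"
      using t by (simp flip: \<chi> \<rho>_mult add: \<rho>_one v0)
    then show "\<chi> t \<in> carrier Gm"
      by auto
    fix s assume s: "s \<in> carrier T"
    have "\<chi> (t \<otimes>\<^bsub>T\<^esub> s) = \<alpha> (\<rho> (inv\<^bsub>T\<^esub> s) (\<rho> (inv\<^bsub>T\<^esub> t) v0))"
      using s t by (simp add: \<chi>_def T.inv_mult_group \<rho>_mult)
    then show "\<chi> (t \<otimes>\<^bsub>T\<^esub> s) = \<chi> t \<otimes>\<^bsub>Gm\<^esub> \<chi> s"
      using s t by (simp add: \<chi> v0)
  qed
  ultimately have "algebraic_character T R \<chi>"
    by (simp add: algebraic_character_def)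
  with \<alpha> \<chi> show ?thesis
    unfolding semiinvariant_def dual_action_def by blast
qed

lemma ex_semiinvariant_pair:
  assumes invariant: "\<forall>t \<in> carrier T. \<forall>x \<in> X. \<rho> t x \<in> X"
    and no_SP: "\<not> separation_property scale X"
    and closed: "zariski_closed scale (char_variety scale X)"
  shows "\<exists>\<alpha> \<beta>. (proj_pt \<alpha>, proj_pt \<beta>) \<in> char_variety scale X \<and>
    semiinvariant T R scale \<rho> \<alpha> \<and> semiinvariant T R scale \<rho> \<beta> \<and> lin_indep_pair \<alpha> \<beta>"
proof -
  \<comment> \<open>Induction on the number \<open>k\<close> of coordinates treated so far. The
    failure of the separation property provides the pair for \<open>k = 0\<close>.\<close>
  have "\<exists>\<alpha> \<beta>. \<alpha> \<in> dual scale \<and> \<beta> \<in> dual scale \<and> lin_indep_pair \<alpha> \<beta> \<and>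
      (\<forall>x\<in>X. \<alpha> x = 0 \<longrightarrow> \<beta> x = 0) \<and>
      (\<forall>i s. i < k \<longrightarrow> s \<noteq> 0 \<longrightarrow> weight_function (\<rho> (\<psi> (coordinate_element n i s))) \<alpha> \<and>
        weight_function (\<rho> (\<psi> (coordinate_element n i s))) \<beta>)" if "k \<le> n" for k
    using that
  proof (induction k)
    case 0
    then show ?case
      using no_SP unfolding separation_property_def by auto
  next
    case (Suc k)
    then obtain \<alpha> \<beta> where \<alpha>\<beta>: "\<alpha> \<in> dual scale" "\<beta> \<in> dual scale" "lin_indep_pair \<alpha> \<beta>"
        "\<forall>x\<in>X. \<alpha> x = 0 \<longrightarrow> \<beta> x = 0"
      and weights: "\<And>i s. i < k \<Longrightarrow> s \<noteq> 0 \<Longrightarrow>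
        weight_function (\<rho> (\<psi> (coordinate_element n i s))) \<alpha> \<and>
        weight_function (\<rho> (\<psi> (coordinate_element n i s))) \<beta>"
      by (meson Suc_leD)
    interpret one_parameter_action scale Basis "\<lambda>s. \<rho> (\<psi> (coordinate_element n k s))"
      using Suc.prems by (intro one_parameter_action_coordinate) simp
    have invariant': "\<rho> (\<psi> (coordinate_element n k s)) x \<in> X" if "s \<noteq> 0" "x \<in> X" for s x
      using invariant that by (simp add: \<psi>_carrier coordinate_element_carrier)
    obtain \<alpha>' \<beta>' where \<alpha>\<beta>': "\<alpha>' \<in> dual scale" "\<beta>' \<in> dual scale" "lin_indep_pair \<alpha>' \<beta>'"
        "\<forall>x\<in>X. \<alpha>' x = 0 \<longrightarrow> \<beta>' x = 0"
      and new: "\<forall>r. r \<noteq> 0 \<longrightarrow> weight_function (\<rho> (\<psi> (coordinate_element n k r))) \<alpha>' \<and>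
        weight_function (\<rho> (\<psi> (coordinate_element n k r))) \<beta>'"
      and old: "\<forall>\<tau>. (\<forall>s v. s \<noteq> 0 \<longrightarrow> \<rho> (\<psi> (coordinate_element n k s)) (\<tau> v) =
          \<tau> (\<rho> (\<psi> (coordinate_element n k s)) v)) \<longrightarrow>
        weight_function \<tau> \<alpha> \<longrightarrow> weight_function \<tau> \<beta> \<longrightarrow>
        weight_function \<tau> \<alpha>' \<and> weight_function \<tau> \<beta>'"
      by (rule ex_limit_pair[OF closed invariant' \<alpha>\<beta>])
    have "weight_function (\<rho> (\<psi> (coordinate_element n i s))) \<alpha>' \<and>
        weight_function (\<rho> (\<psi> (coordinate_element n i s))) \<beta>'" if "i < Suc k" "s \<noteq> 0" for i s
    proof (cases "i = k")
      case True
      with new that show ?thesis by simp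
    next
      \<comment> \<open>An earlier coordinate: its operators commute with those of coordinate
        \<open>k\<close>, so the old weights survive the limit.\<close>
      case False
      with that weights show ?thesis
        by (intro old[rule_format] \<rho>_commute \<psi>_carrier coordinate_element_carrier) auto
    qed
    with \<alpha>\<beta>' show ?case by blast
  qed
  from this[of n] obtain \<alpha> \<beta> where \<alpha>\<beta>: "\<alpha> \<in> dual scale" "\<beta> \<in> dual scale"
      and indep: "lin_indep_pair \<alpha> \<beta>" and van: "\<forall>x\<in>X. \<alpha> x = 0 \<longrightarrow> \<beta> x = 0"
      and weights: "\<And>i s. i < n \<Longrightarrow> s \<noteq> 0 \<Longrightarrow>
        weight_function (\<rho> (\<psi> (coordinate_element n i s))) \<alpha> \<and>
        weight_function (\<rho> (\<psi> (coordinate_element n i s))) \<beta>"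
    by blast
  have nonzero: "\<alpha> \<noteq> (\<lambda>_. 0)" "\<beta> \<noteq> (\<lambda>_. 0)"
    using lin_indep_pair_nonzero(1)[OF indep] lin_indep_pair_nonzero(2)[OF indep, of 0] by simp_all
  have "semiinvariant T R scale \<rho> \<alpha>"
    by (rule semiinvariantI[OF \<alpha>\<beta>(1) nonzero(1) weight_function_torus]) (use weights in simp_all)
  moreover have "semiinvariant T R scale \<rho> \<beta>"
    by (rule semiinvariantI[OF \<alpha>\<beta>(2) nonzero(2) weight_function_torus]) (use weights in simp_all)
  moreover have "(proj_pt \<alpha>, proj_pt \<beta>) \<in> char_variety scale X"
    using \<alpha>\<beta> nonzero van by (simp add: char_variety_iff)
  ultimately show ?thesis
    using indep by blast
qed

end

theorem proposition3:
  fixes T :: "('t, 'm) monoid_scheme"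
    and R :: "('t \<Rightarrow> 'k::alg_closed_field) set"
    and scale :: "'k \<Rightarrow> 'v::ab_group_add \<Rightarrow> 'v"
    and Basis :: "'v set"
    and \<rho> :: "'t \<Rightarrow> 'v \<Rightarrow> 'v"
    and X :: "'v set"
  assumes "finite_dimensional_vector_space scale Basis"
    and "algebraic_torus T R"
    and "rational_representation T R scale \<rho>"
    and "\<forall>t \<in> carrier T. \<forall>x \<in> X. \<rho> t x \<in> X"
    and "\<not> separation_property scale X"
    and "zariski_closed scale (char_variety scale X)"
  shows "\<exists>\<alpha> \<beta>. (proj_pt \<alpha>, proj_pt \<beta>) \<in> char_variety scale X \<and>
    semiinvariant T R scale \<rho> \<alpha> \<and> semiinvariant T R scale \<rho> \<beta> \<and> lin_indep_pair \<alpha> \<beta>"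
proof -
  obtain n \<phi> where "group T" "\<phi> \<in> iso T (Gm_power n)"
    "R = {f. \<exists>g \<in> laurent_functions n. \<forall>t \<in> carrier T. f t = g (\<phi> t)}"
    using assms(2) unfolding algebraic_torus_def by blast
  then have "torus_representation scale Basis T R \<rho> n \<phi>"
    using assms(1,3) by (simp add: torus_representation_def torus_representation_axioms_def)
  then show ?thesis
    using assms(4-6) by (rule torus_representation.ex_semiinvariant_pair)
qed

end
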